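(* Let $A$ be a (possibly nonseparable) $C^*$-algebra, and let $n\in\mathbb{N}$. Assume that there exists a club of separable sub-$C^*$-algebras of $A$ each of whose members $B$ satisfies $\operatorname{xrr}(B) \leq n$. Then $\operatorname{xrr}(A)\leq n$.
   Context: A collection $\mathcal{F}$ of separable sub-$C^*$-algebras of $A$ is $\sigma$-complete if for every countable, upward directed subset $\mathcal{F}_0 \subseteq \mathcal{F}$ the $C^*$-algebra $\overline{\bigcup \mathcal{F}_0}$ belongs to $\mathcal{F}$; it is cofinal if for every separable sub-$C^*$-algebra $B_0\subseteq A$ there is $B\in\mathcal{F}$ with $B_0\subseteq B$. A $\sigma$-complete and cofinal collection is called a club. For a unital $C^*$-algebra $D$, let $D_{\mathrm{sa}}$ be its set of self-adjoint elements and let $\operatorname{Lg}_n(D)_{\mathrm{sa}}$ be the set of tuples $(a_1,\ldots,a_n)\in (D_{\mathrm{sa}})^n$ such that $\sum_{k=1}^n a_k^2$ is invertible in $D$ (the zero algebra is regarded as unital, with $0=1$ invertible). For a $C^*$-algebra $A$ let $M(A)$ be its multiplier algebra and $\pi_A\colon M(A)\to M(A)/A$ the quotient map. For $n\in\mathbb{N}=\{0,1,2,\ldots\}$, $A$ has property $(\Lambda_n)$ if for every $(a_0,\ldots,a_n)\in M(A)_{\mathrm{sa}}^{n+1}$ with $(\pi_A(a_0),\ldots,\pi_A(a_n))\in\operatorname{Lg}_{n+1}(M(A)/A)_{\mathrm{sa}}$ and every $\varepsilon>0$ there is $(b_0,\ldots,b_n)\in\operatorname{Lg}_{n+1}(M(A))_{\mathrm{sa}}$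 with $\|a_j-b_j\|<\varepsilon$ and $\pi_A(a_j)=\pi_A(b_j)$ for $j=0,\ldots,n$. The extension real rank $\operatorname{xrr}(A)$ is the smallest $n\in\mathbb{N}$ such that $A$ has $(\Lambda_m)$ for all $m\geq n$, and $\operatorname{xrr}(A)=\infty$ if no such $n$ exists. *)

theory Defs
  imports "HOL-Analysis.Analysis" "HOL-Algebra.QuotRing" "HOL-Library.Extended_Nat"
begin

section \<open>C*-algebras and their separable sub-C*-algebras\<close>

text \<open>
  C*-algebras are complex and not assumed to be unital; the one-element algebra is allowed.
  The ambient algebra is a type, its sub-C*-algebras are sets. The first axiom on
  the complex scalar multiplication says that it extends the real one which every
  \<^class>\<open>real_normed_algebra\<close> already has.
\<close>

class cstar_algebra = real_normed_algebra + banach +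
  fixes scaleC :: "complex \<Rightarrow> 'a \<Rightarrow> 'a" (infixr "*\<^sub>C" 75)
    and star :: "'a \<Rightarrow> 'a"
  assumes scaleC_of_real: "complex_of_real r *\<^sub>C x = r *\<^sub>R x"
    and scaleC_add_right: "z *\<^sub>C (x + y) = z *\<^sub>C x + z *\<^sub>C y"
    and scaleC_add_left: "(z + w) *\<^sub>C x = z *\<^sub>C x + w *\<^sub>C x"
    and scaleC_scaleC: "z *\<^sub>C w *\<^sub>C x = (z * w) *\<^sub>C x"
    and mult_scaleC_left: "(z *\<^sub>C x) * y = z *\<^sub>C (x * y)"
    and mult_scaleC_right: "x * (z *\<^sub>C y) = z *\<^sub>C (x * y)"
    and norm_scaleC: "norm (z *\<^sub>C x) = cmod z * norm x"
    and star_star: "star (star x) = x"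
    and star_add: "star (x + y) = star x + star y"
    and star_scaleC: "star (z *\<^sub>C x) = cnj z *\<^sub>C star x"
    and star_mult: "star (x * y) = star y * star x"
    and cstar_identity: "norm (star x * x) = (norm x)\<^sup>2"

definition sub_cstar_algebra :: "'a::cstar_algebra set \<Rightarrow> bool" where
  "sub_cstar_algebra B \<longleftrightarrow>
     0 \<in> B \<and> (\<forall>x\<in>B. \<forall>y\<in>B. x + y \<in> B) \<and> (\<forall>z. \<forall>x\<in>B. z *\<^sub>C x \<in> B) \<and>
     (\<forall>x\<in>B. \<forall>y\<in>B. x * y \<in> B) \<and> (\<forall>x\<in>B. star x \<in> B) \<and> closed B"

definition separable_sub_cstar_algebra :: "'a::cstar_algebra set \<Rightarrow> bool" where
  "separable_sub_cstar_algebra B \<longleftrightarrow> sub_cstar_algebra B \<and> separable_space (top_of_set B)"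

text \<open>As usual, upward directed families are nonempty.\<close>

definition upward_directed :: "'a set set \<Rightarrow> bool" where
  "upward_directed F \<longleftrightarrow> F \<noteq> {} \<and> (\<forall>B\<in>F. \<forall>C\<in>F. \<exists>D\<in>F. B \<subseteq> D \<and> C \<subseteq> D)"

definition sigma_complete :: "'a::cstar_algebra set set \<Rightarrow> bool" where
  "sigma_complete F \<longleftrightarrow>
     (\<forall>F0. F0 \<subseteq> F \<and> countable F0 \<and> upward_directed F0 \<longrightarrow> closure (\<Union>F0) \<in> F)"

definition cofinal_family :: "'a::cstar_algebra set set \<Rightarrow> bool" where
  "cofinal_family F \<longleftrightarrow> (\<forall>B0. separable_sub_cstar_algebra B0 \<longrightarrow> (\<exists>B\<in>F. B0 \<subseteq> B))"

definition club :: "'a::cstar_algebra set set \<Rightarrow> bool" where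
  "club F \<longleftrightarrow> (\<forall>B\<in>F. separable_sub_cstar_algebra B) \<and> sigma_complete F \<and> cofinal_family F"


section \<open>Unital C*-algebras with explicit carrier\<close>

text \<open>
  Multiplier algebras and their quotients live on subsets of types of (sets of pairs of)
  functions, so they are represented as rings with carrier, with additional operations.
\<close>

record 'd cstar_ring = "'d ring" +
  cscale :: "complex \<Rightarrow> 'd \<Rightarrow> 'd"
  involution :: "'d \<Rightarrow> 'd"
  cnorm :: "'d \<Rightarrow> real"

definition self_adjoints :: "('d, 'e) cstar_ring_scheme \<Rightarrow> 'd set" where
  "self_adjoints D = {a \<in> carrier D. involution D a = a}"

text \<open>
  An \<open>n\<close>-tuple is a function on \<open>nat\<close> of which only the values at \<open>0, \<dots>, n - 1\<close> matter.
\<close>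

definition Lg_sa :: "nat \<Rightarrow> ('d, 'e) cstar_ring_scheme \<Rightarrow> (nat \<Rightarrow> 'd) set" where
  "Lg_sa n D =
     {a \<in> {..<n} \<rightarrow> self_adjoints D. (\<Oplus>\<^bsub>D\<^esub>k\<in>{..<n}. a k \<otimes>\<^bsub>D\<^esub> a k) \<in> Units D}"

text \<open>
  Quotient by a closed two-sided ideal \<open>I\<close>. The operations on cosets are written as unions of
  the cosets obtained from all representatives, as in \<^const>\<open>rcoset_mult\<close>.
\<close>

definition quotient_cstar :: "('d, 'e) cstar_ring_scheme \<Rightarrow> 'd set \<Rightarrow> 'd set cstar_ring" where
  "quotient_cstar D I = ring.extend (D Quot I)
     (cstar_ring.fields
        (\<lambda>z X. \<Union>x\<in>X. I +>\<^bsub>D\<^esub> cscale D z x)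
        (\<lambda>X. \<Union>x\<in>X. I +>\<^bsub>D\<^esub> involution D x)
        (\<lambda>X. INF x\<in>X. cnorm D x))"


section \<open>The multiplier algebra\<close>

text \<open>
  The multiplier algebra of a C*-algebra \<open>B\<close> is the algebra of its double centralizers
  \<open>(L, R)\<close>. The maps are made extensional, so that equality of double centralizers
  is equality of maps on \<open>B\<close>.
\<close>

definition bounded_operators :: "'a::cstar_algebra set \<Rightarrow> ('a \<Rightarrow> 'a) set" where
  "bounded_operators B =
     {T \<in> B \<rightarrow>\<^sub>E B. (\<forall>x\<in>B. \<forall>y\<in>B. T (x + y) = T x + T y) \<and>
        (\<forall>z. \<forall>x\<in>B. T (z *\<^sub>C x) = z *\<^sub>C T x) \<and>
        (\<exists>K. \<forall>x\<in>B. norm (T x) \<le> K * norm x)}"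

definition operator_norm :: "'a::cstar_algebra set \<Rightarrow> ('a \<Rightarrow> 'a) \<Rightarrow> real" where
  "operator_norm B T = (SUP x\<in>{x \<in> B. norm x \<le> 1}. norm (T x))"

definition double_centralizers :: "'a::cstar_algebra set \<Rightarrow> (('a \<Rightarrow> 'a) \<times> ('a \<Rightarrow> 'a)) set" where
  "double_centralizers B =
     {(L, R). L \<in> bounded_operators B \<and> R \<in> bounded_operators B \<and>
        (\<forall>x\<in>B. \<forall>y\<in>B. L (x * y) = L x * y \<and> R (x * y) = x * R y \<and> x * L y = R x * y)}"

text \<open>The norms of \<open>L\<close> and \<open>R\<close> agree for every double centralizer \<open>(L, R)\<close>.\<close>

definition multiplier_algebra ::
    "'a::cstar_algebra set \<Rightarrow> (('a \<Rightarrow> 'a) \<times> ('a \<Rightarrow> 'a)) cstar_ring" where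
  "multiplier_algebra B =
     \<lparr>carrier = double_centralizers B,
      mult = (\<lambda>(L, R) (L', R'). (\<lambda>x\<in>B. L (L' x), \<lambda>x\<in>B. R' (R x))),
      one = (\<lambda>x\<in>B. x, \<lambda>x\<in>B. x),
      zero = (\<lambda>x\<in>B. 0, \<lambda>x\<in>B. 0),
      add = (\<lambda>(L, R) (L', R'). (\<lambda>x\<in>B. L x + L' x, \<lambda>x\<in>B. R x + R' x)),
      cscale = (\<lambda>z (L, R). (\<lambda>x\<in>B. z *\<^sub>C L x, \<lambda>x\<in>B. z *\<^sub>C R x)),
      involution = (\<lambda>(L, R). (\<lambda>x\<in>B. star (R (star x)), \<lambda>x\<in>B. star (L (star x)))),
      cnorm = (\<lambda>(L, R). operator_norm B L)\<rparr>"

definition multiplier_of ::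
    "'a::cstar_algebra set \<Rightarrow> 'a \<Rightarrow> ('a \<Rightarrow> 'a) \<times> ('a \<Rightarrow> 'a)" where
  "multiplier_of B b = (\<lambda>x\<in>B. b * x, \<lambda>x\<in>B. x * b)"

text \<open>\<open>M(B)/B\<close> and \<open>\<pi>\<^sub>B\<close>, where \<open>B\<close> is identified with its image in \<open>M(B)\<close>.\<close>

definition corona_algebra ::
    "'a::cstar_algebra set \<Rightarrow> (('a \<Rightarrow> 'a) \<times> ('a \<Rightarrow> 'a)) set cstar_ring" where
  "corona_algebra B = quotient_cstar (multiplier_algebra B) (multiplier_of B ` B)"

definition corona_map ::
    "'a::cstar_algebra set \<Rightarrow> ('a \<Rightarrow> 'a) \<times> ('a \<Rightarrow> 'a) \<Rightarrow> (('a \<Rightarrow> 'a) \<times> ('a \<Rightarrow> 'a)) set" where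
  "corona_map B m = (multiplier_of B ` B) +>\<^bsub>multiplier_algebra B\<^esub> m"


section \<open>The extension real rank\<close>

definition property_Lambda :: "nat \<Rightarrow> 'a::cstar_algebra set \<Rightarrow> bool" where
  "property_Lambda n B \<longleftrightarrow>
     (\<forall>a \<in> {..n} \<rightarrow> self_adjoints (multiplier_algebra B). \<forall>\<epsilon>>0.
        (\<lambda>j. corona_map B (a j)) \<in> Lg_sa (n + 1) (corona_algebra B) \<longrightarrow>
        (\<exists>b \<in> Lg_sa (n + 1) (multiplier_algebra B). \<forall>j\<le>n.
           cnorm (multiplier_algebra B) (a j \<ominus>\<^bsub>multiplier_algebra B\<^esub> b j) < \<epsilon> \<and>
           corona_map B (a j) = corona_map B (b j)))"

definition xrr :: "'a::cstar_algebra set \<Rightarrow> enat" where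
  "xrr B =
     (if \<exists>n. \<forall>m\<ge>n. property_Lambda m B
      then enat (LEAST n. \<forall>m\<ge>n. property_Lambda m B) else \<infinity>)"

end

theory Submission
  imports Defs
begin

text \<open>
  The tuples allowed by \<open>(\<Lambda>\<^sub>n)\<close> are \<open>b\<^sub>j = a\<^sub>j - c\<^sub>j\<close> with \<open>c\<^sub>j\<close> small and self-adjoint in \<open>A\<close>.
  Let \<open>d\<close> be an inverse of \<open>\<Sum> a\<^sub>j\<^sup>2\<close> modulo \<open>A\<close>. Closing off, the club has a member \<open>B\<close> which is
  invariant under the multipliers \<open>a\<^sub>j\<close> and \<open>d\<close> and contains the two error terms, so that the
  restrictions of the \<open>a\<^sub>j\<close> to \<open>B\<close> form a tuple to which \<open>(\<Lambda>\<^sub>n)\<close> for \<open>B\<close> applies. It gives \<open>c\<^sub>j\<close> in \<open>B\<close>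
  for which \<open>E = \<Sum> (a\<^sub>j - c\<^sub>j)\<^sup>2\<close> is invertible in \<open>M(B)\<close>, say with inverse \<open>f\<close>. Although \<open>B\<close> need not
  be nondegenerate in \<open>A\<close>, \<open>E\<close> is then invertible in \<open>M(A)\<close>: if \<open>d E = 1 + u\<close> with \<open>u\<close> in \<open>B\<close>, then
  \<open>u f\<close> lies in \<open>B\<close> and \<open>(d - u f) E = 1\<close> holds on all of \<open>A\<close>; likewise on the right.
\<close>

section \<open>Elementary facts on C*-algebras\<close>

lemma scaleC_minus_one: "(-1) *\<^sub>C x = - (x::'a::cstar_algebra)"
  using scaleC_of_real[of "-1" x] by simp

lemma scaleC_zero_right: "z *\<^sub>C 0 = (0::'a::cstar_algebra)"
  using scaleC_add_right[of z 0 "0::'a"] by simp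

lemma star_zero: "star (0::'a::cstar_algebra) = 0"
  using star_add[of 0 "0::'a"] by simp

lemma star_minus: "star (- x) = - star (x::'a::cstar_algebra)"
  using star_add[of x "- x"] by (simp add: star_zero minus_unique)

lemma star_diff: "star (x - y) = star x - star (y::'a::cstar_algebra)"
  using star_add[of x "- y"] by (simp add: star_minus)

text \<open>The C*-identity and submultiplicativity bound the square of \<open>norm y\<close> by
  \<open>norm (star y) * norm y\<close>. Cancelling, and using this for both \<open>x\<close> and
  \<open>star x\<close>, gives the two inequalities.\<close>

lemma norm_star: "norm (star x) = norm (x::'a::cstar_algebra)"
proof -
  have le: "norm y \<le> norm (star y)" for y :: 'a
  proof (cases "y = 0")
    case False
    have "norm y * norm y \<le> norm (star y) * norm y"
      using norm_mult_ineq[of "star y" y] by (simp add: cstar_identity power2_eq_square)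
    then show ?thesis using False by simp
  qed simp
  show ?thesis using le[of x] le[of "star x"] by (simp add: star_star)
qed

lemma mult_star_eq_zero_iff: "x * star x = 0 \<longleftrightarrow> x = (0::'a::cstar_algebra)"
  using cstar_identity[of "star x"] by (auto simp: star_star norm_star star_zero)

lemma continuous_on_star: "continuous_on S (star :: 'a::cstar_algebra \<Rightarrow> 'a)"
  by (rule continuous_on_iff[THEN iffD2])
     (metis dist_norm norm_star star_diff)


section \<open>Multiplier and corona algebras\<close>

text \<open>The operations of the record match on pairs. Equations for the two components can be
  used on arbitrary elements without splitting them.\<close>

lemma fst_multiplier_mult: "fst (m \<otimes>\<^bsub>multiplier_algebra B\<^esub> m') = (\<lambda>x\<in>B. fst m (fst m' x))"
  and snd_multiplier_mult: "snd (m \<otimes>\<^bsub>multiplier_algebra B\<^esub> m') = (\<lambda>x\<in>B. snd m' (snd m x))"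
  and fst_multiplier_add: "fst (m \<oplus>\<^bsub>multiplier_algebra B\<^esub> m') = (\<lambda>x\<in>B. fst m x + fst m' x)"
  and snd_multiplier_add: "snd (m \<oplus>\<^bsub>multiplier_algebra B\<^esub> m') = (\<lambda>x\<in>B. snd m x + snd m' x)"
  and multiplier_one: "\<one>\<^bsub>multiplier_algebra B\<^esub> = (\<lambda>x\<in>B. x, \<lambda>x\<in>B. x)"
  and multiplier_zero: "\<zero>\<^bsub>multiplier_algebra B\<^esub> = (\<lambda>x\<in>B. 0, \<lambda>x\<in>B. 0)"
  and fst_multiplier_involution: "fst (involution (multiplier_algebra B) m) = (\<lambda>x\<in>B. star (snd m (star x)))"
  and snd_multiplier_involution: "snd (involution (multiplier_algebra B) m) = (\<lambda>x\<in>B. star (fst m (star x)))"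
  and carrier_multiplier: "carrier (multiplier_algebra B) = double_centralizers B"
  by (auto simp: multiplier_algebra_def split: prod.splits)

lemmas multiplier_simps = fst_multiplier_mult snd_multiplier_mult fst_multiplier_add
  snd_multiplier_add multiplier_one multiplier_zero carrier_multiplier

lemma multiplier_of_simps:
  "fst (multiplier_of B b) = (\<lambda>x\<in>B. b * x)" "snd (multiplier_of B b) = (\<lambda>x\<in>B. x * b)"
  by (simp_all add: multiplier_of_def)

section \<open>Arithmetic in a sub-C*-algebra \<open>B\<close>, later a club member or
  \<open>UNIV\<close>\<close>

context
  fixes B :: "'a::cstar_algebra set"
  assumes B: "sub_cstar_algebra B"
begin

lemma sub_zero: "0 \<in> B"
  and sub_add: "x \<in> B \<Longrightarrow> y \<in> B \<Longrightarrow> x + y \<in> B"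
  and sub_scaleC: "x \<in> B \<Longrightarrow> z *\<^sub>C x \<in> B"
  and sub_mult: "x \<in> B \<Longrightarrow> y \<in> B \<Longrightarrow> x * y \<in> B"
  and sub_star: "x \<in> B \<Longrightarrow> star x \<in> B"
  using B by (auto simp: sub_cstar_algebra_def)

lemma sub_minus: "x \<in> B \<Longrightarrow> - x \<in> B"
  using sub_scaleC[of x "-1"] by (simp add: scaleC_minus_one)

lemma sub_diff: "x \<in> B \<Longrightarrow> y \<in> B \<Longrightarrow> x - y \<in> B"
  using sub_add[of x "- y"] by (simp add: sub_minus)

lemma sub_sum: "(\<And>k. k \<in> I \<Longrightarrow> f k \<in> B) \<Longrightarrow> sum f I \<in> B"
  by (induction I rule: infinite_finite_induct) (auto intro: sub_add sub_zero)

text \<open>Testing with \<open>star x\<close> suffices, by the C*-identity. An element of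
  \<open>B\<close> is thus determined by its left multiplication on \<open>B\<close>, even if
  \<open>B\<close> acts degenerately on the ambient algebra.\<close>

lemma eq_zero_if_annihilates:
  assumes "x \<in> B" "\<And>y. y \<in> B \<Longrightarrow> x * y = 0"
  shows "x = 0"
  using assms mult_star_eq_zero_iff[of x] sub_star by blast


section \<open>Bounded operators on \<open>B\<close>\<close>

lemma bounded_operatorsI:
  assumes "\<And>x. x \<in> B \<Longrightarrow> T x \<in> B"
    and "\<And>x y. x \<in> B \<Longrightarrow> y \<in> B \<Longrightarrow> T (x + y) = T x + T y"
    and "\<And>z x. x \<in> B \<Longrightarrow> T (z *\<^sub>C x) = z *\<^sub>C T x"
    and "\<And>x. x \<in> B \<Longrightarrow> norm (T x) \<le> K * norm x"
  shows "restrict T B \<in> bounded_operators B"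
  using assms unfolding bounded_operators_def
  by (auto simp: sub_add sub_scaleC intro!: exI[of _ K])

lemma bounded_operatorsD:
  assumes "T \<in> bounded_operators B"
  shows "x \<in> B \<Longrightarrow> T x \<in> B"
    and "x \<in> B \<Longrightarrow> y \<in> B \<Longrightarrow> T (x + y) = T x + T y"
    and "x \<in> B \<Longrightarrow> T (z *\<^sub>C x) = z *\<^sub>C T x"
    and "\<exists>K\<ge>0. \<forall>x\<in>B. norm (T x) \<le> K * norm x"
    and "T \<in> extensional B"
proof -
  obtain K where K: "\<forall>x\<in>B. norm (T x) \<le> K * norm x"
    using assms by (auto simp: bounded_operators_def)
  \<comment> \<open>The definition puts no sign on the bound, and a negative one is possible if
    \<open>B\<close> is zero. A nonnegative bound is what composition of operators needs.\<close>
  have "norm (T x) \<le> max K 0 * norm x" if "x \<in> B" for x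
    using K that mult_right_mono[of K "max K 0" "norm x"] by fastforce
  then show "\<exists>K\<ge>0. \<forall>x\<in>B. norm (T x) \<le> K * norm x"
    by (intro exI[of _ "max K 0"]) auto
qed (use assms in \<open>auto simp: bounded_operators_def PiE_def Pi_def\<close>)

lemma bounded_operators_minus: "T \<in> bounded_operators B \<Longrightarrow> x \<in> B \<Longrightarrow> T (- x) = - T x"
  using bounded_operatorsD(3)[of T x "-1"] by (simp add: scaleC_minus_one)

lemma bounded_operators_diff:
  "T \<in> bounded_operators B \<Longrightarrow> x \<in> B \<Longrightarrow> y \<in> B \<Longrightarrow> T (x - y) = T x - T y"
  using bounded_operatorsD(2)[of T x "- y"] by (simp add: sub_minus bounded_operators_minus)

lemma restrict_add_bounded:
  assumes "S \<in> bounded_operators B" "T \<in> bounded_operators B"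
  shows "(\<lambda>x\<in>B. S x + T x) \<in> bounded_operators B"
proof -
  obtain K K' where K: "\<forall>x\<in>B. norm (S x) \<le> K * norm x" and K': "\<forall>x\<in>B. norm (T x) \<le> K' * norm x"
    using bounded_operatorsD(4)[OF assms(1)] bounded_operatorsD(4)[OF assms(2)] by blast
  have "norm (S x + T x) \<le> (K + K') * norm x" if "x \<in> B" for x
    using K K' that norm_triangle_ineq[of "S x" "T x"] by (fastforce simp: distrib_right)
  then show ?thesis
    by (intro bounded_operatorsI) (auto simp: assms[THEN bounded_operatorsD(1)]
      assms[THEN bounded_operatorsD(2)] assms[THEN bounded_operatorsD(3)] sub_add scaleC_add_right)
qed

lemma restrict_compose_bounded:
  assumes "S \<in> bounded_operators B" "T \<in> bounded_operators B"
  shows "(\<lambda>x\<in>B. S (T x)) \<in> bounded_operators B"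
proof -
  obtain K K' where K: "K \<ge> 0" "\<forall>x\<in>B. norm (S x) \<le> K * norm x" and K': "\<forall>x\<in>B. norm (T x) \<le> K' * norm x"
    using bounded_operatorsD(4)[OF assms(1)] bounded_operatorsD(4)[OF assms(2)] by blast
  have "norm (S (T x)) \<le> K * K' * norm x" if "x \<in> B" for x
  proof -
    have "norm (S (T x)) \<le> K * norm (T x)"
      using K that bounded_operatorsD(1)[OF assms(2)] by blast
    also have "\<dots> \<le> K * (K' * norm x)"
      using K K' that by (intro mult_left_mono) auto
    finally show ?thesis by (simp add: mult.assoc)
  qed
  then show ?thesis
    by (intro bounded_operatorsI) (auto simp: assms[THEN bounded_operatorsD(1)]
      assms[THEN bounded_operatorsD(2)] assms[THEN bounded_operatorsD(3)])
qed

lemma restrict_scaleC_bounded: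
  assumes "T \<in> bounded_operators B"
  shows "(\<lambda>x\<in>B. z *\<^sub>C T x) \<in> bounded_operators B"
proof -
  obtain K where K: "\<forall>x\<in>B. norm (T x) \<le> K * norm x"
    using bounded_operatorsD(4)[OF assms(1)] by blast
  have "norm (z *\<^sub>C T x) \<le> (cmod z * K) * norm x" if "x \<in> B" for x
    using K that by (simp add: norm_scaleC mult_left_mono mult.assoc)
  then show ?thesis
    by (intro bounded_operatorsI[of _ "cmod z * K"]) (auto simp: assms[THEN bounded_operatorsD(1)]
      assms[THEN bounded_operatorsD(2)] assms[THEN bounded_operatorsD(3)] sub_scaleC
      scaleC_add_right scaleC_scaleC mult.commute[of z])
qed

lemma restrict_id_bounded: "(\<lambda>x\<in>B. x) \<in> bounded_operators B"
  by (rule bounded_operatorsI[of _ 1]) auto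

lemma restrict_zero_bounded: "(\<lambda>x\<in>B. 0) \<in> bounded_operators B"
  by (rule bounded_operatorsI[of _ 0]) (auto simp: sub_zero scaleC_zero_right)

lemma restrict_mult_bounded:
  assumes "b \<in> B"
  shows "(\<lambda>x\<in>B. b * x) \<in> bounded_operators B" "(\<lambda>x\<in>B. x * b) \<in> bounded_operators B"
  using assms
  by (auto intro!: bounded_operatorsI[of _ "norm b"] simp: sub_mult algebra_simps mult_scaleC_left
        mult_scaleC_right norm_mult_ineq) (metis mult.commute norm_mult_ineq)

section \<open>Double centralizers and the ring they form\<close>

lemma double_centralizersI:
  assumes "restrict L B \<in> bounded_operators B" "restrict R B \<in> bounded_operators B"
    and "\<And>x y. x \<in> B \<Longrightarrow> y \<in> B \<Longrightarrow> L (x * y) = L x * y"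
    and "\<And>x y. x \<in> B \<Longrightarrow> y \<in> B \<Longrightarrow> R (x * y) = x * R y"
    and "\<And>x y. x \<in> B \<Longrightarrow> y \<in> B \<Longrightarrow> x * L y = R x * y"
  shows "(restrict L B, restrict R B) \<in> double_centralizers B"
  using assms by (simp add: double_centralizers_def sub_mult)

lemma double_centralizersD:
  assumes "m \<in> double_centralizers B"
  shows "fst m \<in> bounded_operators B" "snd m \<in> bounded_operators B"
    and "x \<in> B \<Longrightarrow> y \<in> B \<Longrightarrow> fst m (x * y) = fst m x * y"
    and "x \<in> B \<Longrightarrow> y \<in> B \<Longrightarrow> snd m (x * y) = x * snd m y"
    and "x \<in> B \<Longrightarrow> y \<in> B \<Longrightarrow> x * fst m y = snd m x * y"
    and "x \<in> B \<Longrightarrow> fst m x \<in> B" "x \<in> B \<Longrightarrow> snd m x \<in> B"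
    and "fst m \<in> extensional B" "snd m \<in> extensional B"
    and "x \<in> B \<Longrightarrow> y \<in> B \<Longrightarrow> fst m (x + y) = fst m x + fst m y"
    and "x \<in> B \<Longrightarrow> y \<in> B \<Longrightarrow> snd m (x + y) = snd m x + snd m y"
    and "x \<in> B \<Longrightarrow> y \<in> B \<Longrightarrow> fst m (x - y) = fst m x - fst m y"
    and "x \<in> B \<Longrightarrow> y \<in> B \<Longrightarrow> snd m (x - y) = snd m x - snd m y"
proof -
  show f: "fst m \<in> bounded_operators B" and s: "snd m \<in> bounded_operators B"
    using assms by (auto simp: double_centralizers_def)
  show "x \<in> B \<Longrightarrow> y \<in> B \<Longrightarrow> fst m (x * y) = fst m x * y"
    and "x \<in> B \<Longrightarrow> y \<in> B \<Longrightarrow> snd m (x * y) = x * snd m y"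
    and "x \<in> B \<Longrightarrow> y \<in> B \<Longrightarrow> x * fst m y = snd m x * y"
    using assms by (auto simp: double_centralizers_def)
qed (use bounded_operatorsD double_centralizers_def assms bounded_operators_diff in \<open>auto simp: double_centralizers_def\<close>)

lemma double_centralizers_eqI:
  assumes "m \<in> double_centralizers B" "m' \<in> double_centralizers B"
    and "\<And>x. x \<in> B \<Longrightarrow> fst m x = fst m' x" "\<And>x. x \<in> B \<Longrightarrow> snd m x = snd m' x"
  shows "m = m'"
  using assms double_centralizersD(8,9) by (intro prod_eqI extensionalityI[of _ B]) auto

lemma multiplier_mult_closed:
  assumes "m \<in> double_centralizers B" "m' \<in> double_centralizers B"
  shows "m \<otimes>\<^bsub>multiplier_algebra B\<^esub> m' \<in> double_centralizers B"
proof -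
  note d = assms[THEN double_centralizersD(6)] assms[THEN double_centralizersD(7)]
  have "(\<lambda>x\<in>B. fst m (fst m' x), \<lambda>x\<in>B. snd m' (snd m x)) \<in> double_centralizers B"
    by (rule double_centralizersI)
       (auto simp: d restrict_compose_bounded assms double_centralizersD(1,2)
         assms[THEN double_centralizersD(3)] assms[THEN double_centralizersD(4)]
         assms[THEN double_centralizersD(5)])
  then show ?thesis by (simp add: multiplier_algebra_def split_beta)
qed

lemma multiplier_add_closed:
  assumes "m \<in> double_centralizers B" "m' \<in> double_centralizers B"
  shows "m \<oplus>\<^bsub>multiplier_algebra B\<^esub> m' \<in> double_centralizers B"
proof -
  have "(\<lambda>x\<in>B. fst m x + fst m' x, \<lambda>x\<in>B. snd m x + snd m' x) \<in> double_centralizers B"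
    by (rule double_centralizersI)
       (auto simp: restrict_add_bounded assms double_centralizersD(1,2) algebra_simps
         assms[THEN double_centralizersD(3)] assms[THEN double_centralizersD(4)]
         assms[THEN double_centralizersD(5)])
  then show ?thesis by (simp add: multiplier_algebra_def split_beta)
qed

text \<open>An explicit candidate for the additive inverse, needed before the ring structure gives
  access to the negation of the record. Boundedness is that of scaling by -1.\<close>

lemma multiplier_minus_closed:
  assumes "m \<in> double_centralizers B"
  shows "(\<lambda>x\<in>B. - fst m x, \<lambda>x\<in>B. - snd m x) \<in> double_centralizers B"
  using restrict_scaleC_bounded[OF double_centralizersD(1)[OF assms], of "-1"]
    restrict_scaleC_bounded[OF double_centralizersD(2)[OF assms], of "-1"]
  by (intro double_centralizersI)
     (auto simp: scaleC_minus_one double_centralizersD(3-5)[OF assms])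

lemma multiplier_of_closed: "b \<in> B \<Longrightarrow> multiplier_of B b \<in> double_centralizers B"
  unfolding multiplier_of_def
  by (rule double_centralizersI) (auto simp: restrict_mult_bounded mult.assoc)

lemma multiplier_one_closed: "\<one>\<^bsub>multiplier_algebra B\<^esub> \<in> double_centralizers B"
  unfolding multiplier_one by (rule double_centralizersI) (auto simp: restrict_id_bounded)

lemma multiplier_zero_closed: "\<zero>\<^bsub>multiplier_algebra B\<^esub> \<in> double_centralizers B"
  unfolding multiplier_zero by (rule double_centralizersI) (auto simp: restrict_zero_bounded)

text \<open>The unfolded copies serve goals in which \<open>multiplier_simps\<close> has already
  replaced one and zero by explicit pairs.\<close>

lemmas multiplier_closed = multiplier_mult_closed multiplier_add_closed multiplier_one_closed
  multiplier_zero_closed multiplier_of_closed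
  multiplier_one_closed[unfolded multiplier_one] multiplier_zero_closed[unfolded multiplier_zero]

text \<open>By \<open>double_centralizers_eqI\<close> the equational axioms become identities
  between elements of \<open>B\<close>; only the additive inverse needs a witness.\<close>

lemma multiplier_ring: "ring (multiplier_algebra B)"
proof (rule ringI)
  show "abelian_group (multiplier_algebra B)"
  proof (rule abelian_groupI)
    fix m assume m: "m \<in> carrier (multiplier_algebra B)"
    let ?n = "(\<lambda>x\<in>B. - fst m x, \<lambda>x\<in>B. - snd m x)"
    have n: "?n \<in> double_centralizers B"
      using m multiplier_minus_closed by (simp add: multiplier_simps)
    have "?n \<oplus>\<^bsub>multiplier_algebra B\<^esub> m = \<zero>\<^bsub>multiplier_algebra B\<^esub>"
      using m n by (intro double_centralizers_eqI)
        (auto simp: multiplier_simps multiplier_closed)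
    then show "\<exists>n\<in>carrier (multiplier_algebra B). n \<oplus>\<^bsub>multiplier_algebra B\<^esub> m = \<zero>\<^bsub>multiplier_algebra B\<^esub>"
      using n by (auto simp: multiplier_simps)
  qed ((intro double_centralizers_eqI)?;
       simp add: multiplier_simps multiplier_closed algebra_simps)+
  show "Group.monoid (multiplier_algebra B)"
    by (rule monoidI; (intro double_centralizers_eqI)?;
      simp add: multiplier_simps multiplier_closed double_centralizersD(6,7))
qed ((intro double_centralizers_eqI)?;
     simp add: multiplier_simps multiplier_closed double_centralizersD(6,7,10,11))+

section \<open>The ideal \<open>B\<close> of its multiplier algebra and the corona\<close>

lemma multiplier_of_ideal: "ideal (multiplier_of B ` B) (multiplier_algebra B)"
proof (rule idealI[OF multiplier_ring])
  interpret ring "multiplier_algebra B" by (rule multiplier_ring)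
  show "subgroup (multiplier_of B ` B) (add_monoid (multiplier_algebra B))"
  proof (rule add.subgroupI)
    show "multiplier_of B ` B \<subseteq> carrier (multiplier_algebra B)"
      by (auto simp: carrier_multiplier multiplier_closed)
    show "multiplier_of B ` B \<noteq> {}" using sub_zero by auto
  next
    fix m assume "m \<in> multiplier_of B ` B"
    then obtain b where b: "b \<in> B" "m = multiplier_of B b" by auto
    have "multiplier_of B (- b) \<oplus>\<^bsub>multiplier_algebra B\<^esub> m = \<zero>\<^bsub>multiplier_algebra B\<^esub>"
      using b by (intro double_centralizers_eqI)
        (auto simp: multiplier_simps multiplier_closed sub_minus multiplier_of_simps)
    then have "\<ominus>\<^bsub>multiplier_algebra B\<^esub> m = multiplier_of B (- b)"
      using b by (intro minus_equality)
       (auto simp: carrier_multiplier multiplier_closed sub_minus)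
    then show "\<ominus>\<^bsub>multiplier_algebra B\<^esub> m \<in> multiplier_of B ` B"
      using b sub_minus by auto
  next
    fix m m' assume "m \<in> multiplier_of B ` B" "m' \<in> multiplier_of B ` B"
    then obtain b b' where b: "b \<in> B" "m = multiplier_of B b" "b' \<in> B" "m' = multiplier_of B b'" by auto
    have "m \<oplus>\<^bsub>multiplier_algebra B\<^esub> m' = multiplier_of B (b + b')"
      using b by (intro double_centralizers_eqI)
        (auto simp: multiplier_simps multiplier_closed sub_add multiplier_of_simps algebra_simps)
    then show "m \<oplus>\<^bsub>multiplier_algebra B\<^esub> m' \<in> multiplier_of B ` B"
      using b sub_add by auto
  qed
next
  fix i m assume "i \<in> multiplier_of B ` B" and "m \<in> carrier (multiplier_algebra B)"
  then obtain b where b: "b \<in> B" "i = multiplier_of B b" and m: "m \<in> double_centralizers B"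
    by (auto simp: carrier_multiplier)
  \<comment> \<open>The products of \<open>m\<close> with \<open>b\<close> are again elements of
    \<open>B\<close>: \<open>fst m b\<close> stands for m b, and below \<open>snd m b\<close> stands
    for b m. The mixed identity \<open>x * fst m y = snd m x * y\<close> matches the other component
    in each case.\<close>
  have "m \<otimes>\<^bsub>multiplier_algebra B\<^esub> i = multiplier_of B (fst m b)"
    using b m by (intro double_centralizers_eqI)
      (auto simp: multiplier_simps multiplier_closed multiplier_of_simps double_centralizersD)
  then show "m \<otimes>\<^bsub>multiplier_algebra B\<^esub> i \<in> multiplier_of B ` B"
    using b m by (auto simp: double_centralizersD)
  have "i \<otimes>\<^bsub>multiplier_algebra B\<^esub> m = multiplier_of B (snd m b)"
    using b m by (intro double_centralizers_eqI)
      (auto simp: multiplier_simps multiplier_closed multiplier_of_simps double_centralizersD)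
  then show "i \<otimes>\<^bsub>multiplier_algebra B\<^esub> m \<in> multiplier_of B ` B"
    using b m by (auto simp: double_centralizersD)
qed

text \<open>Cosets of an ideal agree exactly when one representative lies in the coset of the other.
  Written out pointwise, this no longer mentions cosets and exhibits the difference as an element
  \<open>b\<close> of \<open>B\<close>.\<close>

lemma corona_map_eq_iff:
  assumes m: "m \<in> double_centralizers B" and m': "m' \<in> double_centralizers B"
  shows "corona_map B m = corona_map B m' \<longleftrightarrow>
    (\<exists>b\<in>B. \<forall>x\<in>B. fst m x = fst m' x + b * x \<and> snd m x = snd m' x + x * b)"
proof -
  interpret ideal "multiplier_of B ` B" "multiplier_algebra B" by (rule multiplier_of_ideal)
  note car = m[folded carrier_multiplier] m'[folded carrier_multiplier]
  have "corona_map B m = corona_map B m' \<longleftrightarrow> m \<in> corona_map B m'"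
    unfolding corona_map_def
    using a_repr_independence'[of m m'] a_rcos_self[of m] car by auto
  also have "\<dots> \<longleftrightarrow> (\<exists>b\<in>B. m = multiplier_of B b \<oplus>\<^bsub>multiplier_algebra B\<^esub> m')"
    by (auto simp: corona_map_def a_r_coset_def')
  also have "\<dots> \<longleftrightarrow> (\<exists>b\<in>B. \<forall>x\<in>B. fst m x = fst m' x + b * x \<and> snd m x = snd m' x + x * b)"
  proof (rule bex_cong[OF refl])
    fix b assume b: "b \<in> B"
    have "m = multiplier_of B b \<oplus>\<^bsub>multiplier_algebra B\<^esub> m'"
      if "\<forall>x\<in>B. fst m x = fst m' x + b * x \<and> snd m x = snd m' x + x * b"
      by (rule double_centralizers_eqI)
        (use that b m m' in \<open>simp_all add: multiplier_closed multiplier_simps multiplier_of_simps add.commute\<close>)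
    moreover have "fst m x = fst m' x + b * x \<and> snd m x = snd m' x + x * b"
      if "m = multiplier_of B b \<oplus>\<^bsub>multiplier_algebra B\<^esub> m'" "x \<in> B" for x
      unfolding that(1) using that(2) by (simp add: multiplier_simps multiplier_of_simps add.commute)
    ultimately show "(m = multiplier_of B b \<oplus>\<^bsub>multiplier_algebra B\<^esub> m') =
        (\<forall>x\<in>B. fst m x = fst m' x + b * x \<and> snd m x = snd m' x + x * b)"
      by blast
  qed
  finally show ?thesis .
qed

lemma corona_simps:
  "carrier (corona_algebra B) = corona_map B ` double_centralizers B"
  "\<one>\<^bsub>corona_algebra B\<^esub> = corona_map B \<one>\<^bsub>multiplier_algebra B\<^esub>"
  by (auto simp: corona_algebra_def quotient_cstar_def ring.defs FactRing_def A_RCOSETS_def'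
      carrier_multiplier corona_map_def)

lemma corona_mult:
  assumes "m \<in> double_centralizers B" "m' \<in> double_centralizers B"
  shows "corona_map B m \<otimes>\<^bsub>corona_algebra B\<^esub> corona_map B m' =
    corona_map B (m \<otimes>\<^bsub>multiplier_algebra B\<^esub> m')"
  using assms ideal.rcoset_mult_add[OF multiplier_of_ideal, of m m']
  by (simp add: corona_algebra_def quotient_cstar_def ring.defs FactRing_def
      carrier_multiplier corona_map_def)

section \<open>Finite sums and sums of squares\<close>

lemma corona_finsum:
  assumes "finite I" "\<And>k. k \<in> I \<Longrightarrow> f k \<in> double_centralizers B"
    and "\<And>k. k \<in> I \<Longrightarrow> g k = corona_map B (f k)"
  shows "(\<Oplus>\<^bsub>corona_algebra B\<^esub>k\<in>I. g k) =
    corona_map B (\<Oplus>\<^bsub>multiplier_algebra B\<^esub>k\<in>I. f k)"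
proof -
  let ?J = "multiplier_of B ` B" and ?M = "multiplier_algebra B"
  interpret ideal ?J ?M by (rule multiplier_of_ideal)
  interpret Q: ring "?M Quot ?J" by (rule quotient_is_ring)
  note hom = rcos_ring_hom[THEN ring_hom_closed] rcos_ring_hom[THEN ring_hom_add, symmetric]
  have zero: "?J +>\<^bsub>?M\<^esub> \<zero>\<^bsub>?M\<^esub> = \<zero>\<^bsub>?M Quot ?J\<^esub>"
    by (simp add: FactRing_def a_coset_add_zero a_subset)
  have "(\<Oplus>\<^bsub>?M Quot ?J\<^esub>k\<in>I. g k) = ?J +>\<^bsub>?M\<^esub> (\<Oplus>\<^bsub>?M\<^esub>k\<in>I. f k)"
    using assms
  proof (induction I)
    case (insert i I)
    then have "f \<in> I \<rightarrow> carrier ?M" "f i \<in> carrier ?M"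
      by (auto simp: carrier_multiplier)
    with insert show ?case
      by (simp add: hom Pi_def corona_map_def)
  qed (simp add: zero)
  \<comment> \<open>The corona extends the quotient ring by further fields, but a finite sum only
    looks at the ring operations; so it may be computed in the quotient ring, where the quotient map
    is a homomorphism.\<close>
  moreover have "finsum (corona_algebra B) g I = finsum (?M Quot ?J) g I"
    by (simp add: finsum_def finprod_def corona_algebra_def quotient_cstar_def ring.defs)
  ultimately show ?thesis by (simp add: corona_map_def)
qed

lemma multiplier_finsum:
  assumes "finite I" "\<And>k. k \<in> I \<Longrightarrow> f k \<in> double_centralizers B"
  shows "(\<Oplus>\<^bsub>multiplier_algebra B\<^esub>k\<in>I. f k) =
    (\<lambda>x\<in>B. \<Sum>k\<in>I. fst (f k) x, \<lambda>x\<in>B. \<Sum>k\<in>I. snd (f k) x)"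
    (is "?s I = ?t I")
proof -
  interpret ring "multiplier_algebra B" by (rule multiplier_ring)
  show ?thesis using assms
  proof (induction I)
    case empty
    show ?case by (simp add: multiplier_zero restrict_def)
  next
    case (insert i I)
    then have "?s (insert i I) = f i \<oplus>\<^bsub>multiplier_algebra B\<^esub> ?t I"
      by (simp add: finsum_insert carrier_multiplier Pi_def)
    also have "\<dots> = ?t (insert i I)"
      using insert.hyps by (intro prod_eqI) (auto simp: multiplier_simps)
    finally show ?case .
  qed
qed

lemma multiplier_sum_of_squares:
  fixes n :: nat
  assumes "a \<in> {..<n} \<rightarrow> double_centralizers B"
  shows "(\<Oplus>\<^bsub>multiplier_algebra B\<^esub>k\<in>{..<n}. a k \<otimes>\<^bsub>multiplier_algebra B\<^esub> a k) =
    (\<lambda>x\<in>B. \<Sum>k<n. fst (a k) (fst (a k) x), \<lambda>x\<in>B. \<Sum>k<n. snd (a k) (snd (a k) x))"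
    (is "?s = ?t")
    and "(\<Oplus>\<^bsub>multiplier_algebra B\<^esub>k\<in>{..<n}. a k \<otimes>\<^bsub>multiplier_algebra B\<^esub> a k) \<in> double_centralizers B"
proof -
  interpret ring "multiplier_algebra B" by (rule multiplier_ring)
  have a: "a k \<otimes>\<^bsub>multiplier_algebra B\<^esub> a k \<in> double_centralizers B" if "k < n" for k
    using assms that by (auto intro!: multiplier_closed)
  then show "?s = ?t"
    by (subst multiplier_finsum) (auto simp: multiplier_simps cong: restrict_cong)
  show "?s \<in> double_centralizers B"
    by (rule finsum_closed[unfolded carrier_multiplier]) (auto intro: a)
qed

section \<open>Self-adjoint elements and units\<close>

lemma self_adjoints_multiplierI:
  assumes "m \<in> double_centralizers B" "\<And>x. x \<in> B \<Longrightarrow> snd m x = star (fst m (star x))"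
  shows "m \<in> self_adjoints (multiplier_algebra B)"
proof -
  \<comment> \<open>One assumed equation covers both components: replacing x by
    \<open>star x\<close> and taking adjoints turns it into the equation for
    \<open>fst m\<close>.\<close>
  have "fst (involution (multiplier_algebra B) m) = fst m"
    "snd (involution (multiplier_algebra B) m) = snd m"
    using assms double_centralizersD(8,9)[OF assms(1)]
    by (auto intro!: extensionalityI[of _ B]
        simp: fst_multiplier_involution snd_multiplier_involution sub_star star_star)
  then show ?thesis
    using assms(1) by (simp add: self_adjoints_def carrier_multiplier prod_eqI)
qed

lemma self_adjoints_multiplierD:
  assumes "m \<in> self_adjoints (multiplier_algebra B)"
  shows "m \<in> double_centralizers B" "x \<in> B \<Longrightarrow> snd m x = star (fst m (star x))"
proof -
  show "m \<in> double_centralizers B"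
    using assms by (simp add: self_adjoints_def carrier_multiplier)
  assume x: "x \<in> B"
  have "snd m x = snd (involution (multiplier_algebra B) m) x"
    using assms by (simp add: self_adjoints_def)
  with x show "snd m x = star (fst m (star x))"
    by (simp add: snd_multiplier_involution)
qed

text \<open>The involution of the corona is a union over all representatives, so each of them has to
  be considered: the adjoint of b + m is \<open>star b\<close> + m, which stays in the coset of
  m.\<close>

lemma corona_map_self_adjoint:
  assumes "m \<in> self_adjoints (multiplier_algebra B)"
  shows "corona_map B m \<in> self_adjoints (corona_algebra B)"
proof -
  note m = self_adjoints_multiplierD[OF assms]
  interpret ideal "multiplier_of B ` B" "multiplier_algebra B" by (rule multiplier_of_ideal)
  have inv: "corona_map B (involution (multiplier_algebra B) y) = corona_map B m"
    if "y \<in> corona_map B m" for y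
  proof -
    from that obtain b where b: "b \<in> B" "y = multiplier_of B b \<oplus>\<^bsub>multiplier_algebra B\<^esub> m"
      by (auto simp: corona_map_def a_r_coset_def')
    have "involution (multiplier_algebra B) y = multiplier_of B (star b) \<oplus>\<^bsub>multiplier_algebra B\<^esub> m"
      using b(1) unfolding b(2)
      by (intro prod_eqI ext)
        (auto simp: fst_multiplier_involution snd_multiplier_involution multiplier_simps
          multiplier_of_simps m(2) star_add star_mult star_star sub_star)
    then have "involution (multiplier_algebra B) y \<in> corona_map B m"
      using b(1) by (auto simp: corona_map_def a_r_coset_def' sub_star)
    then show ?thesis
      unfolding corona_map_def
      using a_repr_independence' m(1) by (metis carrier_multiplier)
  qed
  \<comment> \<open>The coset is nonempty, so the union of the constant family is its value.\<close>
  have "m \<in> corona_map B m"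
    using a_rcos_self m(1) by (simp add: corona_map_def carrier_multiplier)
  then have "(\<Union>y\<in>corona_map B m. corona_map B (involution (multiplier_algebra B) y)) = corona_map B m"
    using inv by auto
  then show ?thesis
    using m(1) unfolding self_adjoints_def corona_simps
    by (simp add: corona_algebra_def quotient_cstar_def ring.defs cstar_ring.defs corona_map_def)
qed

text \<open>Two one-sided inverse laws with two components each make four identities;
  \<open>r\<close> and \<open>s\<close> are the errors of the parametrix \<open>d\<close> on the
  left and on the right.\<close>

lemma corona_map_Units_iff:
  assumes m: "m \<in> double_centralizers B"
  shows "corona_map B m \<in> Units (corona_algebra B) \<longleftrightarrow>
    (\<exists>d\<in>double_centralizers B. \<exists>r\<in>B. \<exists>s\<in>B. \<forall>x\<in>B.
      fst d (fst m x) = x + r * x \<and> snd m (snd d x) = x + x * r \<and>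
      fst m (fst d x) = x + s * x \<and> snd d (snd m x) = x + x * s)"
proof -
  have "corona_map B m \<in> Units (corona_algebra B) \<longleftrightarrow>
    (\<exists>d\<in>double_centralizers B.
      corona_map B (d \<otimes>\<^bsub>multiplier_algebra B\<^esub> m) = corona_map B \<one>\<^bsub>multiplier_algebra B\<^esub> \<and>
      corona_map B (m \<otimes>\<^bsub>multiplier_algebra B\<^esub> d) = corona_map B \<one>\<^bsub>multiplier_algebra B\<^esub>)"
    using m by (auto simp: Units_def corona_simps corona_mult)
  also have "\<dots> \<longleftrightarrow> (\<exists>d\<in>double_centralizers B. (\<exists>r\<in>B. \<forall>x\<in>B.
      fst d (fst m x) = x + r * x \<and> snd m (snd d x) = x + x * r) \<and>
      (\<exists>s\<in>B. \<forall>x\<in>B. fst m (fst d x) = x + s * x \<and> snd d (snd m x) = x + x * s))"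
    using m by (intro bex_cong refl)
      (simp add: corona_map_eq_iff multiplier_closed, simp add: multiplier_simps)
  finally show ?thesis by blast
qed

section \<open>Differences and their norms\<close>

lemma multiplier_diff:
  assumes "m \<in> double_centralizers B" "m' \<in> double_centralizers B"
  shows "m \<ominus>\<^bsub>multiplier_algebra B\<^esub> m' = (\<lambda>x\<in>B. fst m x - fst m' x, \<lambda>x\<in>B. snd m x - snd m' x)"
proof -
  interpret ring "multiplier_algebra B" by (rule multiplier_ring)
  let ?n = "(\<lambda>x\<in>B. - fst m' x, \<lambda>x\<in>B. - snd m' x)"
  have n: "?n \<in> double_centralizers B"
    using assms(2) by (rule multiplier_minus_closed)
  have "?n \<oplus>\<^bsub>multiplier_algebra B\<^esub> m' = \<zero>\<^bsub>multiplier_algebra B\<^esub>"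
    using assms n by (intro double_centralizers_eqI)
      (simp_all add: multiplier_closed, simp_all add: multiplier_simps)
  then have "\<ominus>\<^bsub>multiplier_algebra B\<^esub> m' = ?n"
    using assms n by (intro minus_equality) (simp_all add: carrier_multiplier)
  then show ?thesis
    unfolding minus_eq by (intro prod_eqI ext) (auto simp: multiplier_simps)
qed

text \<open>The upper bound is submultiplicativity; for nonzero \<open>b\<close> the C*-identity
  shows that the supremum is attained at the normalised adjoint of \<open>b\<close>.\<close>

lemma operator_norm_left_mult:
  assumes b: "b \<in> B"
  shows "operator_norm B (\<lambda>x\<in>B. b * x) = norm b"
proof -
  let ?U = "{x \<in> B. norm x \<le> 1}"
  have le: "norm (b * x) \<le> norm b" if "x \<in> ?U" for x
    using norm_mult_ineq[of b x] mult_left_mono[of "norm x" 1 "norm b"] that by auto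
  have "(SUP x\<in>?U. norm (b * x)) = norm b"
  proof (rule antisym)
    show "(SUP x\<in>?U. norm (b * x)) \<le> norm b"
      using sub_zero by (intro cSUP_least le) auto
    have bdd: "bdd_above ((\<lambda>x. norm (b * x)) ` ?U)"
      using le by (intro bdd_aboveI2) auto
    show "norm b \<le> (SUP x\<in>?U. norm (b * x))"
    proof (cases "b = 0")
      case True
      then show ?thesis using cSUP_upper[OF _ bdd, of 0] sub_zero by simp
    next
      case False
      let ?x = "inverse (norm b) *\<^sub>R star b"
      have "norm (b * star b) = norm b * norm b"
        using cstar_identity[of "star b"] by (simp add: star_star norm_star power2_eq_square)
      then have "norm (b * ?x) = norm b"
        using False by (simp add: norm_mult)
      moreover have "?x \<in> ?U"
        using False b sub_scaleC[OF sub_star[OF b], of "complex_of_real (inverse (norm b))"]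
        unfolding scaleC_of_real by (simp add: norm_star)
      ultimately show ?thesis using cSUP_upper[OF _ bdd, of ?x] by simp
    qed
  qed
  moreover have "(SUP x\<in>?U. norm ((\<lambda>x\<in>B. b * x) x)) = (SUP x\<in>?U. norm (b * x))"
    by (rule SUP_cong) auto
  ultimately show ?thesis by (simp add: operator_norm_def)
qed

text \<open>The value depends on \<open>b\<close> alone and not on the subalgebra, so smallness
  found over a club member carries over to the whole algebra.\<close>

lemma cnorm_multiplier_diff:
  assumes "m \<in> double_centralizers B" "m' \<in> double_centralizers B" "b \<in> B"
    and "\<And>x. x \<in> B \<Longrightarrow> fst m x = fst m' x + b * x"
  shows "cnorm (multiplier_algebra B) (m \<ominus>\<^bsub>multiplier_algebra B\<^esub> m') = norm b"
proof -
  have "cnorm (multiplier_algebra B) (m \<ominus>\<^bsub>multiplier_algebra B\<^esub> m') =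
      operator_norm B (\<lambda>x\<in>B. fst m x - fst m' x)"
    by (simp add: multiplier_diff assms(1,2)) (simp add: multiplier_algebra_def)
  also have "(\<lambda>x\<in>B. fst m x - fst m' x) = (\<lambda>x\<in>B. b * x)"
    using assms(4) by (auto intro: restrict_ext)
  finally show ?thesis using assms(3) by (simp only: operator_norm_left_mult)
qed

section \<open>Invertible sums of squares as identities between elements of \<open>B\<close>\<close>

lemma Lg_sa_corona_iff:
  assumes a: "a \<in> {..<n} \<rightarrow> self_adjoints (multiplier_algebra B)"
  shows "(\<lambda>j. corona_map B (a j)) \<in> Lg_sa n (corona_algebra B) \<longleftrightarrow>
    (\<exists>d\<in>double_centralizers B. \<exists>r\<in>B. \<exists>s\<in>B. \<forall>x\<in>B.
      fst d (\<Sum>k<n. fst (a k) (fst (a k) x)) = x + r * x \<and>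
      (\<Sum>k<n. snd (a k) (snd (a k) (snd d x))) = x + x * r \<and>
      (\<Sum>k<n. fst (a k) (fst (a k) (fst d x))) = x + s * x \<and>
      snd d (\<Sum>k<n. snd (a k) (snd (a k) x)) = x + x * s)"
proof -
  have dc: "a k \<in> double_centralizers B" if "k < n" for k
    using funcset_mem[OF a] self_adjoints_multiplierD(1) that by blast
  then have "a \<in> {..<n} \<rightarrow> double_centralizers B" by auto
  note sq = multiplier_sum_of_squares[OF this]
  have "(\<Oplus>\<^bsub>corona_algebra B\<^esub>k\<in>{..<n}. corona_map B (a k) \<otimes>\<^bsub>corona_algebra B\<^esub> corona_map B (a k)) =
    corona_map B (\<Oplus>\<^bsub>multiplier_algebra B\<^esub>k\<in>{..<n}. a k \<otimes>\<^bsub>multiplier_algebra B\<^esub> a k)"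
    by (rule corona_finsum) (simp_all add: dc multiplier_closed corona_mult)
  moreover have "(\<lambda>j. corona_map B (a j)) \<in> {..<n} \<rightarrow> self_adjoints (corona_algebra B)"
    using funcset_mem[OF a] corona_map_self_adjoint by blast
  ultimately have "(\<lambda>j. corona_map B (a j)) \<in> Lg_sa n (corona_algebra B) \<longleftrightarrow>
    corona_map B (\<Oplus>\<^bsub>multiplier_algebra B\<^esub>k\<in>{..<n}. a k \<otimes>\<^bsub>multiplier_algebra B\<^esub> a k) \<in> Units (corona_algebra B)"
    by (simp add: Lg_sa_def)
  then show ?thesis
    unfolding corona_map_Units_iff[OF sq(2)] unfolding sq(1)
    by (simp add: double_centralizersD(6,7))
qed

lemma Lg_sa_multiplier_inverse:
  assumes "a \<in> Lg_sa n (multiplier_algebra B)"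
  shows "\<exists>f\<in>double_centralizers B. \<forall>x\<in>B.
    fst f (\<Sum>k<n. fst (a k) (fst (a k) x)) = x \<and>
    (\<Sum>k<n. snd (a k) (snd (a k) (snd f x))) = x \<and>
    (\<Sum>k<n. fst (a k) (fst (a k) (fst f x))) = x \<and>
    snd f (\<Sum>k<n. snd (a k) (snd (a k) x)) = x"
proof -
  have "a \<in> {..<n} \<rightarrow> double_centralizers B"
    using assms self_adjoints_multiplierD(1) unfolding Lg_sa_def by blast
  note sq = multiplier_sum_of_squares(1)[OF this]
  obtain f where f: "f \<in> double_centralizers B"
    and l: "f \<otimes>\<^bsub>multiplier_algebra B\<^esub> (\<Oplus>\<^bsub>multiplier_algebra B\<^esub>k\<in>{..<n}. a k \<otimes>\<^bsub>multiplier_algebra B\<^esub> a k)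
      = \<one>\<^bsub>multiplier_algebra B\<^esub>"
    and r: "(\<Oplus>\<^bsub>multiplier_algebra B\<^esub>k\<in>{..<n}. a k \<otimes>\<^bsub>multiplier_algebra B\<^esub> a k) \<otimes>\<^bsub>multiplier_algebra B\<^esub> f
      = \<one>\<^bsub>multiplier_algebra B\<^esub>"
    using assms unfolding Lg_sa_def Units_def carrier_multiplier by auto
  \<comment> \<open>With \<open>e\<close> a variable, the equations can be instantiated below with
    the explicit pair from \<open>sq\<close>, while \<open>l\<close> and \<open>r\<close> still
    apply to the abstract sum.\<close>
  have *: "fst (f \<otimes>\<^bsub>multiplier_algebra B\<^esub> e) x = x" "snd (f \<otimes>\<^bsub>multiplier_algebra B\<^esub> e) x = x"
    "fst (e \<otimes>\<^bsub>multiplier_algebra B\<^esub> f) x = x" "snd (e \<otimes>\<^bsub>multiplier_algebra B\<^esub> f) x = x"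
    if "e = (\<Oplus>\<^bsub>multiplier_algebra B\<^esub>k\<in>{..<n}. a k \<otimes>\<^bsub>multiplier_algebra B\<^esub> a k)" "x \<in> B" for e x
    unfolding that(1) l r using that(2) by (simp_all add: multiplier_simps)
  show ?thesis
    by (rule bexI[OF _ f]) (use *[OF sq[symmetric]] double_centralizersD(6,7)[OF f] in
      \<open>simp add: multiplier_simps\<close>)
qed

text \<open>A left and a right inverse coincide in any ring. Allowing two different ones spares
  comparing the left and right corrections of a parametrix.\<close>

lemma multiplier_UnitsI:
  assumes m: "m \<in> double_centralizers B" and g: "g \<in> double_centralizers B"
    and h: "h \<in> double_centralizers B"
    and "\<And>x. x \<in> B \<Longrightarrow> fst g (fst m x) = x" "\<And>x. x \<in> B \<Longrightarrow> snd m (snd g x) = x"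
    and "\<And>x. x \<in> B \<Longrightarrow> fst m (fst h x) = x" "\<And>x. x \<in> B \<Longrightarrow> snd h (snd m x) = x"
  shows "m \<in> Units (multiplier_algebra B)"
proof -
  interpret ring "multiplier_algebra B" by (rule multiplier_ring)
  have l: "g \<otimes>\<^bsub>multiplier_algebra B\<^esub> m = \<one>\<^bsub>multiplier_algebra B\<^esub>"
    by (rule double_centralizers_eqI)
      (use assms in \<open>simp_all add: multiplier_closed, simp_all add: multiplier_simps\<close>)
  have r: "m \<otimes>\<^bsub>multiplier_algebra B\<^esub> h = \<one>\<^bsub>multiplier_algebra B\<^esub>"
    by (rule double_centralizers_eqI)
      (use assms in \<open>simp_all add: multiplier_closed, simp_all add: multiplier_simps\<close>)
  show ?thesis
    using l r inv_unique[OF l r] m g h by (auto simp: Units_def carrier_multiplier)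
qed

end


section \<open>Restriction of multipliers to invariant subalgebras\<close>

lemma sub_cstar_algebra_UNIV: "sub_cstar_algebra (UNIV :: 'a::cstar_algebra set)"
  by (simp add: sub_cstar_algebra_def)

lemma restrict_double_centralizer:
  fixes B :: "'a::cstar_algebra set"
  assumes B: "sub_cstar_algebra B" and m: "m \<in> double_centralizers UNIV"
    and inv: "fst m ` B \<subseteq> B" "snd m ` B \<subseteq> B"
  shows "(restrict (fst m) B, restrict (snd m) B) \<in> double_centralizers B"
proof (rule double_centralizersI[OF B])
  note D = double_centralizersD[OF sub_cstar_algebra_UNIV m]
  have "restrict T B \<in> bounded_operators B"
    if T: "T \<in> bounded_operators UNIV" "T ` B \<subseteq> B" for T
  proof -
    obtain K where "\<forall>x\<in>UNIV. norm (T x) \<le> K * norm x"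
      using bounded_operatorsD(4)[OF sub_cstar_algebra_UNIV T(1)] by blast
    then show ?thesis
      using T bounded_operatorsD(2,3)[OF sub_cstar_algebra_UNIV T(1)]
      by (intro bounded_operatorsI[OF B, of _ K]) auto
  qed
  then show "restrict (fst m) B \<in> bounded_operators B" "restrict (snd m) B \<in> bounded_operators B"
    using D(1,2) inv by auto
qed (use double_centralizersD(3-5)[OF sub_cstar_algebra_UNIV m] in auto)

lemma Units_multiplier_UNIV_if_restriction_invertible:
  fixes B :: "'a::cstar_algebra set"
  assumes B: "sub_cstar_algebra B"
    and m: "m \<in> double_centralizers (UNIV::'a set)" and d: "d \<in> double_centralizers (UNIV::'a set)"
    and f: "f \<in> double_centralizers B" and "u \<in> B" "v \<in> B"
    and left: "\<And>x. fst d (fst m x) = x + u * x" "\<And>x. snd m (snd d x) = x + x * u"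
    and right: "\<And>x. fst m (fst d x) = x + v * x" "\<And>x. snd d (snd m x) = x + x * v"
    and inv: "\<And>x. x \<in> B \<Longrightarrow> snd m (snd f x) = x" "\<And>x. x \<in> B \<Longrightarrow> fst m (fst f x) = x"
  shows "m \<in> Units (multiplier_algebra UNIV)"
proof -
  note U = sub_cstar_algebra_UNIV
  note M = double_centralizersD[OF U m]
  interpret ring "multiplier_algebra (UNIV::'a set)" by (rule multiplier_ring[OF U])
  \<comment> \<open>On \<open>B\<close> the parametrix \<open>d\<close> differs from the inverse \<open>f\<close> by
    an element \<open>u f = f v\<close> of \<open>B\<close>; subtracting it corrects \<open>d\<close> on all of \<open>A\<close>.\<close>
  let ?g = "d \<ominus>\<^bsub>multiplier_algebra UNIV\<^esub> multiplier_of UNIV (snd f u)"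
  let ?h = "d \<ominus>\<^bsub>multiplier_algebra UNIV\<^esub> multiplier_of UNIV (fst f v)"
  have closed: "multiplier_of UNIV b \<in> double_centralizers (UNIV::'a set)" for b :: 'a
    by (simp add: multiplier_of_closed[OF U])
  have gh: "?g \<in> double_centralizers UNIV" "?h \<in> double_centralizers UNIV"
    using d closed by (auto intro!: minus_closed simp flip: carrier_multiplier)
  \<comment> \<open>The mixed identity for \<open>m\<close> holds for all x in the ambient algebra
    and moves \<open>m\<close> onto \<open>snd f u\<close>. So \<open>f\<close> is needed only at
    the element \<open>u\<close> of \<open>B\<close>, and below only at \<open>v\<close>.\<close>
  have u: "snd f u * fst m x = u * x" for x
    using M(5)[of "snd f u" x] inv(1)[OF \<open>u \<in> B\<close>] by simp
  have v: "snd m x * fst f v = x * v" for x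
    using M(5)[of x "fst f v"] inv(2)[OF \<open>v \<in> B\<close>] by simp
  show ?thesis
    by (rule multiplier_UnitsI[OF U m gh])
      (simp_all add: multiplier_diff[OF U d closed] multiplier_of_simps left right u v M(3,4,12,13)
        inv \<open>u \<in> B\<close> \<open>v \<in> B\<close>)
qed


section \<open>Closing off under countably many operations\<close>

text \<open>Close \<open>S\<close> and 0 in countably many stages under the operations, with scalars
  from a countable dense set \<open>Q\<close> only, so that the union \<open>V\<close> stays
  countable. Its closure is the required algebra and regains all complex scalars.\<close>

lemma separable_sub_cstar_algebra_superset:
  fixes S :: "'a::cstar_algebra set"
  assumes "countable S"
  obtains B where "separable_sub_cstar_algebra B" "S \<subseteq> B"
proof -
  obtain Q :: "complex set" where Q: "countable Q" "closure Q = UNIV"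
    using separable[of "UNIV :: complex set"] by (metis top.extremum_uniqueI)
  define W where "W = rec_nat (insert 0 S) (\<lambda>_ V. V \<union> (\<lambda>(x, y). x + y) ` (V \<times> V)
    \<union> (\<lambda>(x, y). x * y) ` (V \<times> V) \<union> star ` V \<union> (\<lambda>(z, x). z *\<^sub>C x) ` (Q \<times> V))"
  have W0: "W 0 = insert 0 S" by (simp add: W_def)
  have WSuc: "W (Suc k) = W k \<union> (\<lambda>(x, y). x + y) ` (W k \<times> W k)
    \<union> (\<lambda>(x, y). x * y) ` (W k \<times> W k) \<union> star ` W k \<union> (\<lambda>(z, x). z *\<^sub>C x) ` (Q \<times> W k)" for k
    by (simp add: W_def)
  define V where "V = (\<Union>k. W k)"
  have "countable (W k)" for k
    by (induction k) (use assms Q in \<open>auto simp: W0 WSuc\<close>)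
  then have cV: "countable V" by (simp add: V_def)
  have mono: "mono W" by (auto simp: mono_iff_le_Suc WSuc)
  have two: "\<exists>k. x \<in> W k \<and> y \<in> W k" if xy: "x \<in> V" "y \<in> V" for x y
  proof -
    from xy obtain i j where "x \<in> W i" "y \<in> W j" by (auto simp: V_def)
    then show ?thesis using monoD[OF mono, of i "max i j"] monoD[OF mono, of j "max i j"] by auto
  qed
  have V: "x + y \<in> V" "x * y \<in> V" if "x \<in> V" "y \<in> V" for x y
  proof -
    from two[OF that] obtain k where "x \<in> W k" "y \<in> W k" by blast
    then have "x + y \<in> W (Suc k)" "x * y \<in> W (Suc k)" by (force simp: WSuc)+
    then show "x + y \<in> V" "x * y \<in> V" by (auto simp: V_def)
  qed
  have V': "star x \<in> V" "z \<in> Q \<Longrightarrow> z *\<^sub>C x \<in> V" if "x \<in> V" for x z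
  proof -
    from two[OF that that] obtain k where "x \<in> W k" by blast
    then have "star x \<in> W (Suc k)" "z \<in> Q \<Longrightarrow> z *\<^sub>C x \<in> W (Suc k)" by (force simp: WSuc)+
    then show "star x \<in> V" "z \<in> Q \<Longrightarrow> z *\<^sub>C x \<in> V" by (auto simp: V_def)
  qed
  have S: "insert 0 S \<subseteq> V" using W0 by (auto simp: V_def)
  have cl: "V \<subseteq> closure V" by (rule closure_subset)
  have clI: "l \<in> closure V" if "\<And>n. X n \<in> V" "X \<longlonglongrightarrow> l" for X l
    using that by (auto simp: closure_sequential)
  have "sub_cstar_algebra (closure V)"
    unfolding sub_cstar_algebra_def
  proof (intro conjI ballI allI)
    fix x y assume "x \<in> closure V" "y \<in> closure V"
    then obtain X Y where "\<And>n. X n \<in> V" "\<And>n. Y n \<in> V" and XY: "X \<longlonglongrightarrow> x" "Y \<longlonglongrightarrow> y"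
      by (meson closure_sequential)
    then have "\<And>n. X n + Y n \<in> V" "\<And>n. X n * Y n \<in> V" using V by auto
    then show "x + y \<in> closure V" "x * y \<in> closure V"
      using clI[OF _ tendsto_add[OF XY]] clI[OF _ tendsto_mult[OF XY]] by auto
  next
    fix x assume "x \<in> closure V"
    then obtain X where X: "\<And>n. X n \<in> V" "X \<longlonglongrightarrow> x"
      by (meson closure_sequential)
    show "star x \<in> closure V"
      using clI[OF _ continuous_on_tendsto_compose[OF continuous_on_star[of UNIV] X(2)]] X(1) V'(1)
      by auto
    fix z
    \<comment> \<open>\<open>V\<close> is closed only under scalars from \<open>Q\<close>, so scalar
      and vector are approximated together; the estimate that follows is the joint continuity of
      \<open>scaleC\<close>.\<close>
    obtain Z where Z: "\<And>n. Z n \<in> Q" "Z \<longlonglongrightarrow> z"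
      using Q(2) by (metis closure_sequential UNIV_I)
    have "(\<lambda>n. norm (Z n *\<^sub>C X n - z *\<^sub>C x)) \<longlonglongrightarrow> 0"
    proof (rule Lim_null_comparison)
      have "norm (norm (Z n *\<^sub>C X n - z *\<^sub>C x)) \<le> cmod (Z n - z) * norm (X n) + cmod z * norm (X n - x)" for n
      proof -
        have "Z n *\<^sub>C X n - z *\<^sub>C x = (Z n - z) *\<^sub>C X n + z *\<^sub>C (X n - x)"
          using scaleC_add_left[of "Z n - z" z "X n"] scaleC_add_right[of z "X n - x" x] by simp
        then show ?thesis
          using norm_triangle_ineq[of "(Z n - z) *\<^sub>C X n" "z *\<^sub>C (X n - x)"] by (simp add: norm_scaleC)
      qed
      then show "\<forall>\<^sub>F n in sequentially. norm (norm (Z n *\<^sub>C X n - z *\<^sub>C x))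
          \<le> cmod (Z n - z) * norm (X n) + cmod z * norm (X n - x)"
        by (intro always_eventually allI)
      have "(\<lambda>n. cmod (Z n - z)) \<longlonglongrightarrow> 0" "(\<lambda>n. norm (X n - x)) \<longlonglongrightarrow> 0"
        using X(2) Z(2) by (simp_all add: tendsto_norm_zero LIM_zero)
      from tendsto_add[OF tendsto_mult[OF this(1) tendsto_norm[OF X(2)]] tendsto_mult_left[OF this(2), of "cmod z"]]
      show "(\<lambda>n. cmod (Z n - z) * norm (X n) + cmod z * norm (X n - x)) \<longlonglongrightarrow> 0"
        by simp
    qed
    then have "(\<lambda>n. Z n *\<^sub>C X n) \<longlonglongrightarrow> z *\<^sub>C x"
      by (simp add: LIM_zero_iff tendsto_norm_zero_iff)
    then show "z *\<^sub>C x \<in> closure V"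
      using X(1) Z(1) V'(2) by (intro clI[of "\<lambda>n. Z n *\<^sub>C X n"]) auto
  qed (use S cl in auto)
  moreover have "separable_space (top_of_set (closure V))"
    unfolding separable_space_def using cV cl
    by (intro exI[of _ V]) (auto simp: closure_of_subtopology Int_absorb1)
  ultimately show thesis
    using that[of "closure V"] S cl by (auto simp: separable_sub_cstar_algebra_def)
qed

text \<open>Build an increasing sequence in \<open>F\<close> such that every map in \<open>T\<close>
  sends each member into the next. By sigma-completeness the closure of its union is in
  \<open>F\<close>, and continuity extends the invariance to the closure.\<close>

lemma club_invariant_member:
  fixes F :: "'a::cstar_algebra set set" and T :: "('a \<Rightarrow> 'a) set"
  assumes F: "club F" and "countable S" and "countable T" and cont: "\<And>t. t \<in> T \<Longrightarrow> continuous_on UNIV t"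
  shows "\<exists>B\<in>F. S \<subseteq> B \<and> (\<forall>t\<in>T. t ` B \<subseteq> B)"
proof -
  \<comment> \<open>Cofinality speaks of separable subalgebras, so a countable set is first enclosed
    in one.\<close>
  have member: "\<exists>B\<in>F. C \<subseteq> B" if C: "countable C" for C
  proof -
    obtain B where "separable_sub_cstar_algebra B" "C \<subseteq> B"
      by (rule separable_sub_cstar_algebra_superset[OF C])
    then show ?thesis using F unfolding club_def cofinal_family_def by blast
  qed
  \<comment> \<open>It suffices to capture a countable dense subset of \<open>B\<close> and its
    images under \<open>T\<close>, since the new member is closed and the maps are
    continuous.\<close>
  have step: "\<exists>C\<in>F. B \<subseteq> C \<and> (\<forall>t\<in>T. t ` B \<subseteq> C)" if "B \<in> F" for B
  proof -
    have "separable_space (top_of_set B)"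
      using F that by (auto simp: club_def separable_sub_cstar_algebra_def)
    then obtain D where D: "countable D" "D \<subseteq> B" "B \<subseteq> closure D"
      by (auto simp: separable_space_def closure_of_subtopology)
    have "countable (D \<union> (\<Union>t\<in>T. t ` D))" using D \<open>countable T\<close> by auto
    from member[OF this] obtain C where C: "C \<in> F" "D \<union> (\<Union>t\<in>T. t ` D) \<subseteq> C" by auto
    then have "closed C"
      using F by (auto simp: club_def separable_sub_cstar_algebra_def sub_cstar_algebra_def)
    have "t ` B \<subseteq> C" if t: "t \<in> T" for t
    proof -
      have "t ` closure D \<subseteq> C"
        using C t \<open>closed C\<close> by (intro image_closure_subset continuous_on_subset[OF cont]) auto
      then show ?thesis using D by auto
    qed
    moreover have "B \<subseteq> C" using D C \<open>closed C\<close> closure_minimal[of D C] by auto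
    ultimately show ?thesis using C by auto
  qed
  from member[OF \<open>countable S\<close>] obtain B0 where B0: "B0 \<in> F" "S \<subseteq> B0" by auto
  have "\<exists>b. \<forall>k. (b k \<in> F \<and> S \<subseteq> b k) \<and> (b k \<subseteq> b (Suc k) \<and> (\<forall>t\<in>T. t ` b k \<subseteq> b (Suc k)))"
  proof (rule dependent_nat_choice)
    show "\<exists>B. B \<in> F \<and> S \<subseteq> B" using B0 by blast
  next
    fix B and k :: nat assume "B \<in> F \<and> S \<subseteq> B"
    with step[of B] show "\<exists>C. (C \<in> F \<and> S \<subseteq> C) \<and> B \<subseteq> C \<and> (\<forall>t\<in>T. t ` B \<subseteq> C)"
      by blast
  qed
  then obtain b where "\<forall>k. (b k \<in> F \<and> S \<subseteq> b k) \<and> (b k \<subseteq> b (Suc k) \<and> (\<forall>t\<in>T. t ` b k \<subseteq> b (Suc k)))"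
    by (rule exE)
  then have b: "\<And>k. b k \<in> F" "\<And>k. S \<subseteq> b k" "\<And>k. b k \<subseteq> b (Suc k)"
    "\<And>k t. t \<in> T \<Longrightarrow> t ` b k \<subseteq> b (Suc k)" by simp_all
  have mono: "mono b" using b(3) by (simp add: mono_iff_le_Suc)
  have "upward_directed (range b)"
    unfolding upward_directed_def
    using monoD[OF mono] by (auto, metis max.cobounded1 max.cobounded2)
  then have "closure (\<Union>(range b)) \<in> F"
    using F b(1) unfolding club_def sigma_complete_def
    by (metis countable_image[OF countableI_type] image_subsetI)
  moreover have "S \<subseteq> closure (\<Union>(range b))"
    using b(2)[of 0] closure_subset[of "\<Union>(range b)"] by auto
  moreover have "t ` closure (\<Union>(range b)) \<subseteq> closure (\<Union>(range b))" if "t \<in> T" for t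
  proof (rule image_closure_subset)
    show "t ` \<Union>(range b) \<subseteq> closure (\<Union>(range b))"
      using b(4)[OF that] closure_subset[of "\<Union>(range b)"] by blast
  qed (auto intro: continuous_on_subset[OF cont[OF that]])
  ultimately show ?thesis by blast
qed

lemma continuous_on_multiplier:
  assumes "m \<in> double_centralizers (UNIV :: 'a::cstar_algebra set)"
  shows "continuous_on UNIV (fst m)" "continuous_on UNIV (snd m)"
proof -
  note U = sub_cstar_algebra_UNIV
  have "continuous_on UNIV T" if T: "T \<in> bounded_operators UNIV" for T :: "'a \<Rightarrow> 'a"
  proof -
    obtain K where K: "\<forall>x. norm (T x) \<le> K * norm x"
      using bounded_operatorsD(4)[OF U T] by auto
    have "bounded_linear T"
      using bounded_operatorsD(2,3)[OF U T] K
      by (intro bounded_linear_intro[of _ K]) (auto simp: scaleC_of_real[symmetric] mult.commute)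
    then show ?thesis by (rule linear_continuous_on)
  qed
  then show "continuous_on UNIV (fst m)" "continuous_on UNIV (snd m)"
    using double_centralizersD(1,2)[OF U assms] by auto
qed


section \<open>The extension real rank\<close>

text \<open>The condition inside \<open>LEAST\<close> is inherited by larger numbers, so the least
  witness is at most \<open>n\<close> exactly when \<open>n\<close> is a witness.\<close>

lemma xrr_le_iff: "xrr B \<le> enat n \<longleftrightarrow> (\<forall>m\<ge>n. property_Lambda m B)"
proof
  assume le: "xrr B \<le> enat n"
  then have ex: "\<exists>n. \<forall>m\<ge>n. property_Lambda m B"
    by (auto simp: xrr_def split: if_splits)
  then have "(LEAST n. \<forall>m\<ge>n. property_Lambda m B) \<le> n"
    using le by (simp add: xrr_def)
  then show "\<forall>m\<ge>n. property_Lambda m B"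
    using LeastI_ex[OF ex] by (meson order_trans)
next
  assume "\<forall>m\<ge>n. property_Lambda m B"
  then show "xrr B \<le> enat n"
    using Least_le[of "\<lambda>n. \<forall>m\<ge>n. property_Lambda m B" n] by (auto simp: xrr_def)
qed

lemma property_Lambda_if_club:
  fixes F :: "'a::cstar_algebra set set"
  assumes F: "club F" and Lambda: "\<And>B. B \<in> F \<Longrightarrow> property_Lambda n B"
  shows "property_Lambda n (UNIV :: 'a set)"
  unfolding property_Lambda_def
proof (intro ballI allI impI)
  fix a and \<epsilon> :: real
  assume "a \<in> {..n} \<rightarrow> self_adjoints (multiplier_algebra (UNIV::'a set))" and "\<epsilon> > 0"
    and Lg: "(\<lambda>j. corona_map UNIV (a j)) \<in> Lg_sa (n + 1) (corona_algebra (UNIV::'a set))"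
  \<comment> \<open>\<open>property_Lambda\<close> indexes tuples by \<open>{..n}\<close> and
    \<open>Lg_sa\<close> by \<open>{..<n+1}\<close>; the second form is kept from here on.\<close>
  then have a_sa: "a \<in> {..<n+1} \<rightarrow> self_adjoints (multiplier_algebra (UNIV::'a set))"
    by (simp add: lessThan_Suc_atMost)
  note U = sub_cstar_algebra_UNIV[where ?'a = 'a]
  have a: "a k \<in> double_centralizers UNIV" "\<And>x. snd (a k) x = star (fst (a k) (star x))"
    if "k < n + 1" for k
    using self_adjoints_multiplierD[OF U funcset_mem[OF a_sa, of k]] that by auto
  obtain d r s where d: "d \<in> double_centralizers UNIV" and drs:
    "\<And>x. fst d (\<Sum>k<n+1. fst (a k) (fst (a k) x)) = x + r * x"
    "\<And>x. (\<Sum>k<n+1. snd (a k) (snd (a k) (snd d x))) = x + x * r"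
    "\<And>x. (\<Sum>k<n+1. fst (a k) (fst (a k) (fst d x))) = x + s * x"
    "\<And>x. snd d (\<Sum>k<n+1. snd (a k) (snd (a k) x)) = x + x * s"
    using Lg unfolding Lg_sa_corona_iff[OF U a_sa] by blast
  define T where "T = {fst d, snd d} \<union> (\<lambda>k. fst (a k)) ` {..<n+1} \<union> (\<lambda>k. snd (a k)) ` {..<n+1}"
  have T: "countable {r, s}" "countable T" "\<And>t. t \<in> T \<Longrightarrow> continuous_on UNIV t"
    using continuous_on_multiplier[OF a(1)] continuous_on_multiplier[OF d] by (auto simp: T_def)
  obtain B where "B \<in> F" and rs: "{r, s} \<subseteq> B" and inv: "\<And>t. t \<in> T \<Longrightarrow> t ` B \<subseteq> B"
    using club_invariant_member[OF F T] by blast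
  then have B: "sub_cstar_algebra B"
    using F by (auto simp: club_def separable_sub_cstar_algebra_def)
  have dB: "fst d x \<in> B" "snd d x \<in> B" if "x \<in> B" for x
    using inv[of "fst d"] inv[of "snd d"] that by (auto simp: T_def)
  have aB: "fst (a k) x \<in> B" "snd (a k) x \<in> B" if "k < n + 1" "x \<in> B" for k x
    using inv[of "fst (a k)"] inv[of "snd (a k)"] that by (auto simp: T_def)

  \<comment> \<open>Outside \<open>B\<close> the maps become \<open>undefined\<close>, as membership
    in \<open>double_centralizers B\<close> demands.\<close>
  define rho where "rho m = (restrict (fst m) B, restrict (snd m) B)" for m :: "('a \<Rightarrow> 'a) \<times> ('a \<Rightarrow> 'a)"
  have rho_a: "rho (a k) \<in> double_centralizers B" if "k < n + 1" for k
    unfolding rho_def by (rule restrict_double_centralizer[OF B a(1)]) (use that aB in auto)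
  have rho_d: "rho d \<in> double_centralizers B"
    unfolding rho_def by (rule restrict_double_centralizer[OF B d]) (use dB in auto)
  have rho_sa: "(\<lambda>k. rho (a k)) \<in> {..<n+1} \<rightarrow> self_adjoints (multiplier_algebra B)"
    by (intro funcsetI self_adjoints_multiplierI[OF B] rho_a)
      (auto simp: rho_def a(2) sub_star[OF B])
  have sumB: "(\<Sum>k<n+1. fst (a k) (fst (a k) x)) \<in> B" "(\<Sum>k<n+1. snd (a k) (snd (a k) x)) \<in> B"
    if "x \<in> B" for x
    by (intro sub_sum[OF B] aB that; simp)+
  have sumrho: "(\<Sum>k<n+1. fst (rho (a k)) (fst (rho (a k)) x)) = (\<Sum>k<n+1. fst (a k) (fst (a k) x))"
    "(\<Sum>k<n+1. snd (rho (a k)) (snd (rho (a k)) x)) = (\<Sum>k<n+1. snd (a k) (snd (a k) x))"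
    if "x \<in> B" for x
    using that by (intro sum.cong refl; simp add: rho_def aB)+
  \<comment> \<open>The equations \<open>drs\<close> hold for all x; restricted to the invariant
    \<open>B\<close> they say that \<open>rho d\<close> is a parametrix there, with the same errors
    \<open>r\<close> and \<open>s\<close>.\<close>
  have rho_Lg: "(\<lambda>k. corona_map B (rho (a k))) \<in> Lg_sa (n + 1) (corona_algebra B)"
    unfolding Lg_sa_corona_iff[OF B rho_sa]
  proof (intro bexI ballI)
    fix x assume x: "x \<in> B"
    have *: "fst (rho d) y = fst d y" "snd (rho d) y = snd d y" if "y \<in> B" for y
      using that by (simp_all add: rho_def)
    show "fst (rho d) (\<Sum>k<n+1. fst (rho (a k)) (fst (rho (a k)) x)) = x + r * x \<and>
      (\<Sum>k<n+1. snd (rho (a k)) (snd (rho (a k)) (snd (rho d) x))) = x + x * r \<and>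
      (\<Sum>k<n+1. fst (rho (a k)) (fst (rho (a k)) (fst (rho d) x))) = x + s * x \<and>
      snd (rho d) (\<Sum>k<n+1. snd (rho (a k)) (snd (rho (a k)) x)) = x + x * s"
      by (simp only: *[OF x] *[OF sumB(1)[OF x]] *[OF sumB(2)[OF x]] sumrho[OF x]
        sumrho[OF dB(1)[OF x]] sumrho[OF dB(2)[OF x]] drs simp_thms)
  qed (use rs rho_d in auto)
  have rho_sa': "(\<lambda>k. rho (a k)) \<in> {..n} \<rightarrow> self_adjoints (multiplier_algebra B)"
    using rho_sa by (simp add: lessThan_Suc_atMost)
  obtain b where b: "b \<in> Lg_sa (n + 1) (multiplier_algebra B)"
    and close: "\<And>j. j \<le> n \<Longrightarrow>
      cnorm (multiplier_algebra B) (rho (a j) \<ominus>\<^bsub>multiplier_algebra B\<^esub> b j) < \<epsilon>"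
    and same: "\<And>j. j \<le> n \<Longrightarrow> corona_map B (rho (a j)) = corona_map B (b j)"
    using Lambda[OF \<open>B \<in> F\<close>, unfolded property_Lambda_def, rule_format, OF rho_sa' \<open>\<epsilon> > 0\<close> rho_Lg]
    by blast
  have b_sa: "b k \<in> self_adjoints (multiplier_algebra B)" if "k < n + 1" for k
    using b that by (auto simp: Lg_sa_def)
  note b_dc = self_adjoints_multiplierD(1)[OF B b_sa]
  \<comment> \<open>Equal cosets in the corona of \<open>B\<close> mean that
    \<open>rho (a k)\<close> and \<open>b k\<close> differ by an element of
    \<open>B\<close>.\<close>
  have "\<forall>k\<in>{..<n+1}. \<exists>c. c \<in> B \<and> (\<forall>x\<in>B. fst (rho (a k)) x = fst (b k) x + c * x \<and>
    snd (rho (a k)) x = snd (b k) x + x * c)"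
  proof
    fix k assume "k \<in> {..<n+1}"
    then show "\<exists>c. c \<in> B \<and> (\<forall>x\<in>B. fst (rho (a k)) x = fst (b k) x + c * x \<and>
      snd (rho (a k)) x = snd (b k) x + x * c)"
      using same[of k] corona_map_eq_iff[OF B rho_a b_dc, of k k] by auto
  qed
  from bchoice[OF this] obtain c where "\<forall>k\<in>{..<n+1}. c k \<in> B \<and>
      (\<forall>x\<in>B. fst (rho (a k)) x = fst (b k) x + c k * x \<and> snd (rho (a k)) x = snd (b k) x + x * c k)"
    by (rule exE)
  then have cB: "\<And>k. k < n + 1 \<Longrightarrow> c k \<in> B"
    and c: "\<And>k x. k < n + 1 \<Longrightarrow> x \<in> B \<Longrightarrow> fst (rho (a k)) x = fst (b k) x + c k * x"
      "\<And>k x. k < n + 1 \<Longrightarrow> x \<in> B \<Longrightarrow> snd (rho (a k)) x = snd (b k) x + x * c k"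
    by auto
  have bc: "fst (b k) x = fst (a k) x - c k * x" "snd (b k) x = snd (a k) x - x * c k"
    if "k < n + 1" "x \<in> B" for k x
    using c[OF that] that(2) by (simp_all add: rho_def)
  \<comment> \<open>\<open>a k\<close> and \<open>b k\<close> are self-adjoint, but they can be
    compared only on \<open>B\<close>; left multiplication on \<open>B\<close> determines elements
    of \<open>B\<close>, which is enough.\<close>
  have c_sa: "star (c k) = c k" if k: "k < n + 1" for k
  proof -
    have "(c k - star (c k)) * y = 0" if y: "y \<in> B" for y
    proof -
      have "star (fst (b k) y) = snd (b k) (star y)"
        using self_adjoints_multiplierD(2)[OF B b_sa[OF k], of "star y"] y
        by (simp add: sub_star[OF B] star_star)
      then have "star (c k * y) = star (star (c k) * y)"
        using y k by (simp add: bc sub_star[OF B] a(2) star_diff star_star star_mult)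
      then have "c k * y = star (c k) * y" by (metis star_star)
      then show ?thesis by (simp add: left_diff_distrib)
    qed
    then have "c k - star (c k) = 0"
      by (rule eq_zero_if_annihilates[OF B sub_diff[OF B cB[OF k] sub_star[OF B cB[OF k]]]])
    then show ?thesis by simp
  qed
  have c_small: "norm (c k) < \<epsilon>" if k: "k < n + 1" for k
    using close[of k] cnorm_multiplier_diff[OF B rho_a[OF k] b_dc[OF k] cB[OF k] c(1)[OF k]] k
    by simp

  \<comment> \<open>Subtracting \<open>c k\<close> from \<open>a k\<close> over the whole algebra
    gives multipliers that agree with \<open>b k\<close> on \<open>B\<close>.\<close>
  define e where "e k = a k \<ominus>\<^bsub>multiplier_algebra UNIV\<^esub> multiplier_of UNIV (c k)" for k
  interpret ring "multiplier_algebra (UNIV::'a set)" by (rule multiplier_ring[OF U])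
  have c_dc: "multiplier_of UNIV (c k) \<in> double_centralizers UNIV" for k
    by (simp add: multiplier_of_closed[OF U])
  have e_dc: "e k \<in> double_centralizers UNIV" if "k < n + 1" for k
    unfolding e_def using a(1)[OF that] c_dc by (auto intro!: minus_closed simp flip: carrier_multiplier)
  have e: "fst (e k) x = fst (a k) x - c k * x" "snd (e k) x = snd (a k) x - x * c k"
    if "k < n + 1" for k x
    by (simp_all add: e_def multiplier_diff[OF U a(1)[OF that] c_dc] multiplier_of_simps)
  have e_sa: "e k \<in> self_adjoints (multiplier_algebra UNIV)" if "k < n + 1" for k
    using that by (intro self_adjoints_multiplierI[OF U e_dc])
      (simp_all add: e a(2) star_diff star_mult star_star c_sa)

  have e_fun: "e \<in> {..<n+1} \<rightarrow> double_centralizers UNIV" using e_dc by auto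
  define E where "E = (\<Oplus>\<^bsub>multiplier_algebra UNIV\<^esub>k\<in>{..<n+1}. e k \<otimes>\<^bsub>multiplier_algebra UNIV\<^esub> e k)"
  have E_dc: "E \<in> double_centralizers UNIV"
    unfolding E_def by (rule multiplier_sum_of_squares(2)[OF U e_fun])
  have E_e: "fst E x = (\<Sum>k<n+1. fst (e k) (fst (e k) x))" "snd E x = (\<Sum>k<n+1. snd (e k) (snd (e k) x))" for x
    unfolding E_def multiplier_sum_of_squares(1)[OF U e_fun] by simp_all
  \<comment> \<open>From (a - c)^2 = a^2 - (a c + c a - c^2): \<open>w\<close> is the sum of the
    brackets, an element of \<open>B\<close> because \<open>fst (a k) (c k)\<close> and
    \<open>snd (a k) (c k)\<close> represent the mixed products.\<close>
  define w where "w = (\<Sum>k<n+1. fst (a k) (c k) + snd (a k) (c k) - c k * c k)"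
  have wB: "w \<in> B"
    unfolding w_def by (intro sub_sum[OF B] sub_diff[OF B] sub_add[OF B] sub_mult[OF B] aB cB) auto
  note A = double_centralizersD[OF U a(1)]
  note D = double_centralizersD[OF U d]
  have E_fst: "fst E x = (\<Sum>k<n+1. fst (a k) (fst (a k) x)) - w * x" for x
    unfolding E_e w_def sum_distrib_right sum_subtractf[symmetric]
    by (intro sum.cong refl) (simp add: e A(12) A(3) A(5) algebra_simps)
  have E_snd: "snd E x = (\<Sum>k<n+1. snd (a k) (snd (a k) x)) - x * w" for x
    unfolding E_e w_def sum_distrib_left sum_subtractf[symmetric]
    by (intro sum.cong refl) (simp add: e A(13) A(4) A(5)[symmetric] algebra_simps)
  obtain f where f: "f \<in> double_centralizers B"
    "\<And>x. x \<in> B \<Longrightarrow> (\<Sum>k<n+1. snd (b k) (snd (b k) (snd f x))) = x"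
    "\<And>x. x \<in> B \<Longrightarrow> (\<Sum>k<n+1. fst (b k) (fst (b k) (fst f x))) = x"
    using Lg_sa_multiplier_inverse[OF B b] by blast
  \<comment> \<open>On \<open>B\<close> the multiplier \<open>E\<close> is the sum of the squares of
    the \<open>b k\<close>, which \<open>f\<close> inverts. The inner values must stay in
    \<open>B\<close> for \<open>bc\<close> to apply twice.\<close>
  have E_b: "fst E x = (\<Sum>k<n+1. fst (b k) (fst (b k) x))" "snd E x = (\<Sum>k<n+1. snd (b k) (snd (b k) x))"
    if "x \<in> B" for x
    unfolding E_e using that
    by (intro sum.cong refl; simp add: e bc aB cB sub_diff[OF B] sub_mult[OF B])+
  have E_unit: "E \<in> Units (multiplier_algebra UNIV)"
  proof (rule Units_multiplier_UNIV_if_restriction_invertible[OF B E_dc d f(1)])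
    \<comment> \<open>Since E is the sum of the squares of the \<open>a k\<close> minus
      \<open>w\<close>, the products d E and E d have errors r - d w and s - w d. Invariance of
      \<open>B\<close> under both components of \<open>d\<close> keeps these in
      \<open>B\<close>.\<close>
    show "r - fst d w \<in> B" "s - snd d w \<in> B"
      using rs wB dB by (auto intro: sub_diff[OF B])
    show "fst d (fst E x) = x + (r - fst d w) * x" "snd E (snd d x) = x + x * (r - fst d w)"
      "fst E (fst d x) = x + (s - snd d w) * x" "snd d (snd E x) = x + x * (s - snd d w)" for x
      unfolding E_fst E_snd by (simp_all only: D(12,13) UNIV_I drs D(3,4) D(5)[symmetric])
        (simp_all add: algebra_simps D(5))
    show "snd E (snd f x) = x" "fst E (fst f x) = x" if "x \<in> B" for x
      using that f E_b double_centralizersD(6,7)[OF B f(1)] by simp_all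
  qed
  have "e \<in> Lg_sa (n + 1) (multiplier_algebra UNIV)"
    using e_sa E_unit by (auto simp: Lg_sa_def E_def)
  \<comment> \<open>By construction \<open>a j\<close> and \<open>e j\<close> differ by the element
    \<open>c j\<close>, which gives both the norm estimate and the equality of cosets.\<close>
  moreover have "cnorm (multiplier_algebra UNIV) (a j \<ominus>\<^bsub>multiplier_algebra UNIV\<^esub> e j) < \<epsilon> \<and>
      corona_map UNIV (a j) = corona_map UNIV (e j)" if "j \<le> n" for j
  proof -
    from that have j: "j < n + 1" by simp
    show ?thesis
      using cnorm_multiplier_diff[OF U a(1)[OF j] e_dc[OF j], of "c j"] c_small[OF j] e[OF j]
        corona_map_eq_iff[OF U a(1)[OF j] e_dc[OF j]]
      by auto
  qed
  ultimately show "\<exists>b\<in>Lg_sa (n + 1) (multiplier_algebra (UNIV::'a set)). \<forall>j\<le>n.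
      cnorm (multiplier_algebra UNIV) (a j \<ominus>\<^bsub>multiplier_algebra UNIV\<^esub> b j) < \<epsilon> \<and>
      corona_map UNIV (a j) = corona_map UNIV (b j)"
    by blast
qed

theorem theorem4p6:
  fixes n :: nat
  assumes "\<exists>F :: 'a::cstar_algebra set set. club F \<and> (\<forall>B\<in>F. xrr B \<le> enat n)"
  shows "xrr (UNIV :: 'a set) \<le> enat n"
  \<comment> \<open>The same club serves for every level m with m \<ge> n.\<close>
  using assms property_Lambda_if_club unfolding xrr_le_iff by blast

end
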